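(* Let $\Gamma$ and $\Theta$ be finite simple oriented graphs with vertex sets $V_\Gamma=\{y_1,\dots,y_m\}$ and $V_\Theta=\{x_1,\dots,x_n\}$, where $m,n\ge 1$. For a monoid homomorphism $\varphi:\mathbf{HK}_\Gamma\to\mathbf{HK}_\Theta$ put $\Phi(\varphi)=(c(\varphi(y_1)),\dots,c(\varphi(y_m)))$, and for a sequence $(X_1,\dots,X_m)$ of subsets of $V_\Theta$ let $\Psi(X_1,\dots,X_m)$ be the $n\times m$ Boolean matrix whose $(i,j)$ entry is $1$ if $x_i\in X_j$ and $0$ if $x_i\notin X_j$. Let $\widetilde{\mathcal S}_{\Gamma,\Theta}$ be the set of $(\Gamma,\Theta)$-admissible sequences. Then the map $\Psi\circ\Phi:\mathrm{Hom}(\mathbf{HK}_\Gamma,\mathbf{HK}_\Theta)\to\Psi(\widetilde{\mathcal S}_{\Gamma,\Theta})$ is a (well-defined) bijection.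
   Context: A finite simple oriented graph is a finite directed graph with no multiple arrows, no loops and no oriented cycles of length $2$. Write $x_i\overset{\Theta}{\to}x_j$ if there is an arrow from $x_i$ to $x_j$ in $\Theta$ (similarly $y_i\overset{\Gamma}{\to}y_j$). Distinct vertices are not connected if there is no arrow between them in either direction. The Hecke--Kiselman monoid $\mathbf{HK}_\Theta$ is the monoid generated by $x_1,\dots,x_n$ subject to the relations: $x_i^2=x_i$; $x_ix_j=x_jx_i$ if $x_i,x_j$ are not connected in $\Theta$; $x_ix_jx_i=x_jx_ix_j=x_ix_j$ if $x_i\overset{\Theta}{\to}x_j$. $\mathbf{HK}_\Gamma$ is defined likewise with generators $y_1,\dots,y_m$. $\mathrm{Hom}(\mathbf{HK}_\Gamma,\mathbf{HK}_\Theta)$ is the set of monoid homomorphisms (preserving the identity). The content $c(x)\subseteq V_\Theta$ of $x\in\mathbf{HK}_\Theta$ is the set of letters (vertices) occurring in any word in the generators that represents $x$; it is independent of the word because the relations preserve the set of occurring letters. For $X\subseteq V_\Theta$, $\Theta[X]$ is the full (induced) subgraph of $\Theta$ on $X$, and $\mathcal A_\Theta$ is the set of $X\subseteq V_\Theta$ such that $\Theta[X]$ contains no oriented cycles. For $X,Y\in\mathcal A_\Theta$, the condition $p_\Theta(X,Y)$ holds if and only if there do not exist $x_b\in Y\setminus X$, $x_a\in X\setminus Y$, an integer $r\ge 0$ and $x_{i_1},\dots,x_{i_r}\in X\cap Y$ with $x_b\overset{\Theta}{\to}x_{i_1}\overset{\Theta}{\to}\cdots\overset{\Theta}{\to}x_{i_r}\overset{\Theta}{\to}x_a$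 (for $r=0$ this chain means $x_b\overset{\Theta}{\to}x_a$). A sequence $(X_1,\dots,X_m)$ of subsets of $V_\Theta$ is $(\Gamma,\Theta)$-admissible if for all $i,j\in\{1,\dots,m\}$: (i) $X_i\in\mathcal A_\Theta$; (ii) $p_\Theta(X_i,X_j)$ and $p_\Theta(X_j,X_i)$ both hold if $y_i$ and $y_j$ are not connected in $\Gamma$; (iii) $p_\Theta(X_i,X_j)$ holds if $y_i\overset{\Gamma}{\to}y_j$. *)

theory Defs
  imports "Graph_Theory.Digraph_Component" "Jordan_Normal_Form.Matrix"
begin

section \<open>Finite simple oriented graphs\<close>

text \<open>The locale \<^locale>\<open>digraph\<close> of the AFP entry Graph_Theory already requires finiteness and
  excludes loops and multiple arcs.\<close>

locale simple_oriented_graph = digraph G for G (structure) +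
  assumes no_two_cycle: "u \<rightarrow> v \<Longrightarrow> \<not> v \<rightarrow> u"

definition not_connected :: "('a, 'b) pre_digraph \<Rightarrow> 'a \<Rightarrow> 'a \<Rightarrow> bool" where
  "not_connected G u v \<longleftrightarrow> u \<noteq> v \<and> \<not> u \<rightarrow>\<^bsub>G\<^esub> v \<and> \<not> v \<rightarrow>\<^bsub>G\<^esub> u"

section \<open>Hecke--Kiselman monoids\<close>

text \<open>The free monoid on the vertices is the set of lists over them; the relation below is the
  congruence on it that is generated by the defining relations.\<close>

inductive hk_eq :: "('a, 'b) pre_digraph \<Rightarrow> 'a list \<Rightarrow> 'a list \<Rightarrow> bool"
  for G :: "('a, 'b) pre_digraph" where
  idem: "x \<in> verts G \<Longrightarrow> hk_eq G [x, x] [x]"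
| comm: "x \<in> verts G \<Longrightarrow> y \<in> verts G \<Longrightarrow> not_connected G x y \<Longrightarrow> hk_eq G [x, y] [y, x]"
| arrow1: "x \<in> verts G \<Longrightarrow> y \<in> verts G \<Longrightarrow> x \<rightarrow>\<^bsub>G\<^esub> y \<Longrightarrow> hk_eq G [x, y, x] [x, y]"
| arrow2: "x \<in> verts G \<Longrightarrow> y \<in> verts G \<Longrightarrow> x \<rightarrow>\<^bsub>G\<^esub> y \<Longrightarrow> hk_eq G [y, x, y] [x, y]"
| refl: "w \<in> lists (verts G) \<Longrightarrow> hk_eq G w w"
| sym: "hk_eq G u v \<Longrightarrow> hk_eq G v u"
| trans: "hk_eq G u v \<Longrightarrow> hk_eq G v w \<Longrightarrow> hk_eq G u w"
| mult: "hk_eq G u v \<Longrightarrow> hk_eq G u' v' \<Longrightarrow> hk_eq G (u @ u') (v @ v')"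

definition hk_rel :: "('a, 'b) pre_digraph \<Rightarrow> ('a list \<times> 'a list) set" where
  "hk_rel G = {(u, v). hk_eq G u v}"

definition hk_class :: "('a, 'b) pre_digraph \<Rightarrow> 'a list \<Rightarrow> 'a list set" where
  "hk_class G w = hk_rel G `` {w}"

definition HK :: "('a, 'b) pre_digraph \<Rightarrow> 'a list set monoid" where
  "HK G = \<lparr>carrier = lists (verts G) // hk_rel G,
           mult = (\<lambda>A B. \<Union>u\<in>A. \<Union>v\<in>B. hk_class G (u @ v)),
           one = hk_class G []\<rparr>"

definition hk_gen :: "('a, 'b) pre_digraph \<Rightarrow> 'a \<Rightarrow> 'a list set" where
  "hk_gen G x = hk_class G [x]"

definition content :: "'a list set \<Rightarrow> 'a set" where
  "content A = (\<Union>w\<in>A. set w)"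

text \<open>The library's \<^const>\<open>hom\<close> does not ask for preservation of the unit.  Homomorphisms are
  made \<^const>\<open>extensional\<close> so that equality of functions is equality on the carrier.\<close>

definition monoid_Hom :: "('a, 'c) monoid_scheme \<Rightarrow> ('b, 'd) monoid_scheme \<Rightarrow> ('a \<Rightarrow> 'b) set" where
  "monoid_Hom M N = {\<phi> \<in> hom M N \<inter> extensional (carrier M). \<phi> \<one>\<^bsub>M\<^esub> = \<one>\<^bsub>N\<^esub>}"

lemma hk_eq_lists: "hk_eq G u v \<Longrightarrow> u \<in> lists (verts G) \<and> v \<in> lists (verts G)"
  by (induction rule: hk_eq.induct) auto

lemma hk_eq_set: "hk_eq G u v \<Longrightarrow> set u = set v"
  by (induction rule: hk_eq.induct) auto

lemma equiv_hk_rel: "equiv (lists (verts G)) (hk_rel G)"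
proof (rule equivI)
  show "hk_rel G \<subseteq> lists (verts G) \<times> lists (verts G)"
    unfolding hk_rel_def using hk_eq_lists by blast
  show "refl_on (lists (verts G)) (hk_rel G)"
    unfolding refl_on_def hk_rel_def by (simp add: hk_eq.refl)
  show "Relation.sym (hk_rel G)"
    unfolding sym_def hk_rel_def by (simp add: hk_eq.sym)
  show "Relation.trans (hk_rel G)"
    unfolding trans_def hk_rel_def by (auto dest: hk_eq.trans)
qed

lemma hk_class_eq_iff:
  assumes "u \<in> lists (verts G)" "v \<in> lists (verts G)"
  shows "hk_class G u = hk_class G v \<longleftrightarrow> hk_eq G u v"
  unfolding hk_class_def using eq_equiv_class_iff[OF equiv_hk_rel assms]
  by (simp add: hk_rel_def)

lemma carrier_HK: "carrier (HK G) = hk_class G ` lists (verts G)"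
  by (auto simp: HK_def quotient_def hk_class_def)

lemma one_HK: "\<one>\<^bsub>HK G\<^esub> = hk_class G []"
  by (simp add: HK_def)

lemma mult_hk_class:
  assumes "u \<in> lists (verts G)" "v \<in> lists (verts G)"
  shows "hk_class G u \<otimes>\<^bsub>HK G\<^esub> hk_class G v = hk_class G (u @ v)"
proof -
  have "hk_class G (u' @ v') = hk_class G (u @ v)"
    if "u' \<in> hk_class G u" "v' \<in> hk_class G v" for u' v'
  proof -
    have *: "hk_eq G u u'" "hk_eq G v v'"
      using that by (auto simp: hk_class_def hk_rel_def)
    have **: "hk_eq G (u' @ v') (u @ v)" by (intro hk_eq.mult hk_eq.sym[OF *(1)] hk_eq.sym[OF *(2)])
    then show ?thesis using hk_eq_lists[OF **] hk_class_eq_iff[of "u' @ v'" G "u @ v"] by blast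
  qed
  moreover have "u \<in> hk_class G u" "v \<in> hk_class G v"
    using assms by (auto simp: hk_class_def hk_rel_def intro: hk_eq.refl)
  ultimately have "(\<Union>u'\<in>hk_class G u. \<Union>v'\<in>hk_class G v. hk_class G (u' @ v')) = hk_class G (u @ v)"
    by blast
  then show ?thesis by (simp add: HK_def)
qed

lemma monoid_HK: "monoid (HK G)"
proof (rule monoidI)
  fix x y z
  assume x: "x \<in> carrier (HK G)" and y: "y \<in> carrier (HK G)"
  then obtain u v where uv: "u \<in> lists (verts G)" "v \<in> lists (verts G)"
    "x = hk_class G u" "y = hk_class G v" by (auto simp: carrier_HK)
  then have "u @ v \<in> lists (verts G)" by auto
  with uv show "x \<otimes>\<^bsub>HK G\<^esub> y \<in> carrier (HK G)"
    unfolding uv(3,4) mult_hk_class[OF uv(1,2)] carrier_HK by blast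
  assume "z \<in> carrier (HK G)"
  then obtain w where w: "w \<in> lists (verts G)" "z = hk_class G w" by (auto simp: carrier_HK)
  then have "v @ w \<in> lists (verts G)" using uv by auto
  with uv w \<open>u @ v \<in> _\<close> show "x \<otimes>\<^bsub>HK G\<^esub> y \<otimes>\<^bsub>HK G\<^esub> z = x \<otimes>\<^bsub>HK G\<^esub> (y \<otimes>\<^bsub>HK G\<^esub> z)"
    by (simp only: mult_hk_class append_assoc)
next
  have Nil: "[] \<in> lists (verts G)" by simp
  then show "\<one>\<^bsub>HK G\<^esub> \<in> carrier (HK G)" unfolding one_HK carrier_HK by blast
  fix x assume "x \<in> carrier (HK G)"
  then obtain u where "u \<in> lists (verts G)" "x = hk_class G u" by (auto simp: carrier_HK)
  with Nil show "\<one>\<^bsub>HK G\<^esub> \<otimes>\<^bsub>HK G\<^esub> x = x" "x \<otimes>\<^bsub>HK G\<^esub> \<one>\<^bsub>HK G\<^esub> = x"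
    by (simp_all only: one_HK mult_hk_class append_Nil append_Nil2)
qed

lemma content_hk_class:
  assumes "w \<in> lists (verts G)"
  shows "content (hk_class G w) = set w"
proof -
  have "w \<in> hk_class G w"
    using assms by (auto simp: hk_class_def hk_rel_def intro: hk_eq.refl)
  moreover have "set v = set w" if "v \<in> hk_class G w" for v
    using that hk_eq_set[of G w v] by (simp add: hk_class_def hk_rel_def)
  ultimately show ?thesis unfolding content_def by blast
qed

section \<open>Admissible sequences\<close>

definition acyclic_sets :: "('a, 'b) pre_digraph \<Rightarrow> 'a set set" where
  "acyclic_sets G = {X. X \<subseteq> verts G \<and> \<not> (\<exists>p. pre_digraph.cycle (G \<restriction> X) p)}"

text \<open>The list \<open>zs\<close> holds the intermediate vertices of the chain; \<open>zs = []\<close> is the case of a single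
  arrow.\<close>

definition p_cond :: "('a, 'b) pre_digraph \<Rightarrow> 'a set \<Rightarrow> 'a set \<Rightarrow> bool" where
  "p_cond G X Y \<longleftrightarrow>
     \<not> (\<exists>b \<in> Y - X. \<exists>a \<in> X - Y. \<exists>zs \<in> lists (X \<inter> Y).
          successively (\<lambda>u v. u \<rightarrow>\<^bsub>G\<^esub> v) (b # zs @ [a]))"

text \<open>Sequences of sets are lists.  The argument \<open>ys\<close> enumerates the vertices of \<open>\<Gamma>\<close>; list positions
  and matrix indices count from 0.\<close>

definition admissible ::
  "('a, 'b) pre_digraph \<Rightarrow> ('c, 'd) pre_digraph \<Rightarrow> 'a list \<Rightarrow> 'c set list \<Rightarrow> bool" where
  "admissible \<Gamma> \<Theta> ys Xs \<longleftrightarrow>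
     length Xs = length ys \<and>
     (\<forall>i < length ys. \<forall>j < length ys.
        Xs ! i \<in> acyclic_sets \<Theta> \<and>
        (not_connected \<Gamma> (ys ! i) (ys ! j) \<longrightarrow>
           p_cond \<Theta> (Xs ! i) (Xs ! j) \<and> p_cond \<Theta> (Xs ! j) (Xs ! i)) \<and>
        (ys ! i \<rightarrow>\<^bsub>\<Gamma>\<^esub> ys ! j \<longrightarrow> p_cond \<Theta> (Xs ! i) (Xs ! j)))"

definition Phi_map ::
  "('a, 'b) pre_digraph \<Rightarrow> 'a list \<Rightarrow> ('a list set \<Rightarrow> 'c list set) \<Rightarrow> 'c set list" where
  "Phi_map \<Gamma> ys \<phi> = map (\<lambda>y. content (\<phi> (hk_gen \<Gamma> y))) ys"

text \<open>Boolean matrices have entries in \<^typ>\<open>bool\<close>, with \<^const>\<open>True\<close> for 1 and \<^const>\<open>False\<close> for 0.\<close>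

definition Psi_map :: "'c list \<Rightarrow> 'c set list \<Rightarrow> bool mat" where
  "Psi_map xs Xs = mat (length xs) (length Xs) (\<lambda>(i, j). xs ! i \<in> Xs ! j)"

end

theory Submission
  imports Defs
begin

text \<open>An idempotent with content \<open>X\<close> exists only if \<open>X\<close> induces an acyclic graph, and it is then the
  zero element of the submonoid generated by \<open>X\<close>, hence determined by \<open>X\<close>.  A homomorphism from
  \<open>HK \<Gamma>\<close> is thus a family of zero elements \<open>e(X\<^sub>y)\<close>, and it remains to see that
  \<open>e(X) e(Y) e(X) = e(X) e(Y)\<close> holds iff \<open>p_cond \<Theta> X Y\<close>, in which case \<open>e(X) e(Y)\<close> is the zero element
  for \<open>X \<union> Y\<close>.  Elements are told apart by the actions of the monoid on vertex states given by
  sequential dynamical systems.\<close>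

section \<open>Words in Hecke--Kiselman monoids\<close>

declare hk_eq.trans [trans]

lemma hk_eq_append_left:
  "hk_eq G u v \<Longrightarrow> set w \<subseteq> verts G \<Longrightarrow> hk_eq G (w @ u) (w @ v)"
  by (rule hk_eq.mult[OF hk_eq.refl]) auto

lemma hk_eq_append_right:
  "hk_eq G u v \<Longrightarrow> set w \<subseteq> verts G \<Longrightarrow> hk_eq G (u @ w) (v @ w)"
  by (rule hk_eq.mult[OF _ hk_eq.refl]) auto

lemma hk_eq_verts: "hk_eq G u v \<Longrightarrow> set u \<subseteq> verts G \<and> set v \<subseteq> verts G"
  using hk_eq_lists by fastforce

text \<open>Erasing letters from a defining relation leaves that relation, an instance of
  \<open>idem\<close> or a reflexive pair: \<open>[x, y, x]\<close> against \<open>[x, y]\<close>,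
  for example, becomes \<open>[x, x]\<close> against \<open>[x]\<close>.\<close>

lemma hk_eq_filter: "hk_eq G u v \<Longrightarrow> hk_eq G (filter P u) (filter P v)"
  by (induction rule: hk_eq.induct) (auto intro: hk_eq.intros)

text \<open>Every nonempty closed walk contains a cycle, so absence of cycles is acyclicity of the
  arrow relation, which gives access to well-foundedness.\<close>

lemma mem_acyclic_sets_iff:
  assumes "wf_digraph G"
  shows "X \<in> acyclic_sets G \<longleftrightarrow> X \<subseteq> verts G \<and> acyclic (arcs_ends (G \<restriction> X))"
proof -
  interpret wf_digraph G by fact
  interpret X: wf_digraph "G \<restriction> X" by (rule wellformed_induce_subgraph)
  have "(\<exists>p. X.cycle p) \<longleftrightarrow> (\<exists>u. u \<rightarrow>\<^sup>+\<^bsub>G \<restriction> X\<^esub> u)"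
    using X.closed_w_imp_cycle unfolding X.cycle_def X.closed_w_def X.reachable1_awalk by blast
  then show ?thesis unfolding acyclic_sets_def acyclic_def by blast
qed

lemma (in wf_digraph) dominates_induce_subgraph_iff:
  "u \<rightarrow>\<^bsub>G \<restriction> X\<^esub> v \<longleftrightarrow> u \<in> X \<and> v \<in> X \<and> u \<rightarrow>\<^bsub>G\<^esub> v"
  by (auto simp: arcs_ends_def arc_to_ends_def)

lemma acyclic_sets_mono:
  assumes "wf_digraph G" "X \<in> acyclic_sets G" "Y \<subseteq> X"
  shows "Y \<in> acyclic_sets G"
proof -
  interpret wf_digraph G by fact
  have "arcs_ends (G \<restriction> Y) \<subseteq> arcs_ends (G \<restriction> X)"
    using assms(3) by (auto simp: dominates_induce_subgraph_iff)
  then show ?thesis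
    using assms by (auto simp: mem_acyclic_sets_iff intro: acyclic_subset)
qed

section \<open>Sequential dynamical systems\<close>

text \<open>Updating one vertex at a time, by a rule that depends only on the states of its
  in-neighbours, satisfies the Hecke--Kiselman relations.\<close>

definition local_rule :: "('a, 'b) pre_digraph \<Rightarrow> ('a \<Rightarrow> ('a \<Rightarrow> 's) \<Rightarrow> 's) \<Rightarrow> bool" where
  "local_rule G g \<longleftrightarrow> (\<forall>x f f'. (\<forall>y. y \<rightarrow>\<^bsub>G\<^esub> x \<longrightarrow> f y = f' y) \<longrightarrow> g x f = g x f')"

definition run :: "('a \<Rightarrow> ('a \<Rightarrow> 's) \<Rightarrow> 's) \<Rightarrow> 'a list \<Rightarrow> ('a \<Rightarrow> 's) \<Rightarrow> 'a \<Rightarrow> 's" where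
  "run g = fold (\<lambda>x f. f(x := g x f))"

lemma run_simps [simp]:
  "run g [] f = f"
  "run g (x # w) f = run g w (f(x := g x f))"
  "run g (u @ v) f = run g v (run g u f)"
  by (simp_all add: run_def)

lemma run_notin: "a \<notin> set w \<Longrightarrow> run g w f a = f a"
  by (induction w arbitrary: f) auto

lemma (in simple_oriented_graph) no_loop: "\<not> u \<rightarrow>\<^bsub>G\<^esub> u"
  using adj_not_same by blast

text \<open>For an arrow from \<open>x\<close> to \<open>y\<close>, the rule at \<open>x\<close>
  does not see \<open>y\<close>. Hence the second update of \<open>x\<close> in
  \<open>[x, y, x]\<close> recomputes the value already there, and the first update of
  \<open>y\<close> in \<open>[y, x, y]\<close> is overwritten before it matters.\<close>

lemma (in simple_oriented_graph) run_hk_eq: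
  assumes "local_rule G g" "hk_eq G u v"
  shows "run g u f = run g v f"
proof -
  have upd: "g y (f(x := c)) = g y f" if "\<not> x \<rightarrow>\<^bsub>G\<^esub> y" for x y c and f :: "'a \<Rightarrow> 'c"
    using assms(1) that unfolding local_rule_def by (metis fun_upd_other)
  have upd2: "g z (f(y := c, x := d)) = g z (f(x := d))"
    if "\<not> y \<rightarrow>\<^bsub>G\<^esub> z" for x y z c d and f :: "'a \<Rightarrow> 'c"
  proof -
    have "\<forall>y'. y' \<rightarrow>\<^bsub>G\<^esub> z \<longrightarrow> (f(y := c, x := d)) y' = (f(x := d)) y'" using that by auto
    then show ?thesis using assms(1) unfolding local_rule_def by blast
  qed
  from assms(2) show ?thesis
    by (induction arbitrary: f rule: hk_eq.induct)
      (auto simp: upd upd2 no_loop no_two_cycle not_connected_def fun_upd_twist)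
qed

text \<open>For a monotone rule, trajectories that start from a state with \<open>f y \<le> g y f\<close> throughout are
  increasing, so a closed one is constant.\<close>

lemma run_increasing:
  fixes g :: "'a \<Rightarrow> ('a \<Rightarrow> 's::order) \<Rightarrow> 's"
  assumes mono: "\<And>x. mono (g x)" and "\<And>y. f y \<le> g y f"
  shows "f \<le> run g w f \<and> (\<forall>y. run g w f y \<le> g y (run g w f))"
  using assms(2)
proof (induction w arbitrary: f)
  case (Cons x w)
  let ?f = "f(x := g x f)"
  have le: "f \<le> ?f" using Cons.prems by (auto simp: le_fun_def)
  have "?f y \<le> g y ?f" for y
    using monoD[OF mono le] Cons.prems order_trans by (cases "y = x") fastforce+
  from Cons.IH[of ?f, OF this] le show ?case by (metis order_trans run_simps(2))
qed simp

lemma run_fixed: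
  fixes g :: "'a \<Rightarrow> ('a \<Rightarrow> 's::order) \<Rightarrow> 's"
  assumes mono: "\<And>x. mono (g x)" and "\<And>y. f y \<le> g y f"
    and "run g w f = f" "x \<in> set w"
  shows "g x f = f x"
  using assms(3,4)
proof (induction w)
  case (Cons z w)
  let ?f = "f(z := g z f)"
  have "f \<le> ?f \<and> (\<forall>y. ?f y \<le> g y ?f)"
    using run_increasing[of g f "[z]"] assms(1,2) by simp
  moreover from this have "?f \<le> run g w ?f" using run_increasing[of g ?f w] mono by blast
  \<comment> \<open>Squeezed by \<open>f \<le> ?f \<le> run g w ?f = f\<close>.\<close>
  ultimately have "?f = f" using Cons.prems(1) by auto
  then show ?case using Cons by (metis fun_upd_same run_simps(2) set_ConsD)
qed simp

text \<open>Started from zero, an idempotent word reaches a state that it fixes, and by monotonicity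
  the update at each of its letters fixes that state too. Such a state increases strictly along the
  arrows within \<open>set w\<close>, which no cycle allows.\<close>

lemma (in simple_oriented_graph) idempotent_imp_acyclic:
  assumes "hk_eq G (w @ w) w"
  shows "set w \<in> acyclic_sets G"
proof -
  \<comment> \<open>The successor makes a fixed value exceed those of all in-neighbours; the sum
    keeps the rule monotone.\<close>
  define g where "g x f = (\<Sum>y | y \<rightarrow>\<^bsub>G\<^esub> x. Suc (f y))" for x and f :: "'a \<Rightarrow> nat"
  define f where "f = run g w (\<lambda>_. 0)"
  have local: "local_rule G g" unfolding local_rule_def g_def by auto
  have mono: "mono (g x)" for x
    unfolding g_def by (intro monoI sum_mono) (auto simp: le_fun_def)
  have "run g w f = f"
    using run_hk_eq[OF local assms, of "\<lambda>_. 0"] by (simp add: f_def)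
  moreover have "f y \<le> g y f" for y
    using run_increasing[of g "\<lambda>_. 0" w] mono by (simp add: f_def)
  ultimately have fixed: "g x f = f x" if "x \<in> set w" for x
    using run_fixed[of g f w x] mono that by blast
  have "f u < f v" if "u \<rightarrow>\<^bsub>G \<restriction> set w\<^esub> v" for u v
  proof -
    have uv: "v \<in> set w" "u \<rightarrow>\<^bsub>G\<^esub> v" using that by (simp_all add: dominates_induce_subgraph_iff)
    \<comment> \<open>Over an infinite index set the sum would be 0.\<close>
    have "finite {y. y \<rightarrow>\<^bsub>G\<^esub> v}"
      by (rule finite_subset[OF _ finite_verts]) (auto dest: adj_in_verts)
    with uv have "Suc (f u) \<le> g v f" unfolding g_def by (intro member_le_sum) auto
    with fixed[OF uv(1)] show ?thesis by simp
  qed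
  then have "acyclic ((arcs_ends (G \<restriction> set w))\<inverse>)" by (intro acyclicI_order[of _ f]) auto
  then show ?thesis
    using hk_eq_verts[OF assms] by (auto simp: mem_acyclic_sets_iff wf_digraph_axioms)
qed

lemma successively_propagate:
  assumes "successively R (b # zs @ [a])" "P b"
    and "\<And>u v. R u v \<Longrightarrow> v \<in> insert a (set zs) \<Longrightarrow> P u \<Longrightarrow> P v"
  shows "P a"
  using assms by (induction zs arbitrary: b) auto

text \<open>An infection that breaks out at \<open>b\<close> spreads along arrows to updated vertices.  It reaches \<open>a\<close>
  when \<open>w2\<close> is followed by \<open>w1\<close>, but not when \<open>w1\<close> is followed by \<open>w2\<close>.\<close>

lemma (in simple_oriented_graph) absorb_imp_p_cond:
  assumes idem: "hk_eq G (w2 @ w2) w2" and absorb: "hk_eq G (w1 @ w2 @ w1) (w1 @ w2)"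
  shows "p_cond G (set w1) (set w2)"
  unfolding p_cond_def
proof (intro notI, elim bexE)
  fix b a zs
  assume b: "b \<in> set w2 - set w1" and a: "a \<in> set w1 - set w2"
    and zs: "zs \<in> lists (set w1 \<inter> set w2)" and chain: "successively (\<lambda>u v. u \<rightarrow>\<^bsub>G\<^esub> v) (b # zs @ [a])"
  define g where "g x f \<longleftrightarrow> x = b \<or> (\<exists>y. y \<rightarrow>\<^bsub>G\<^esub> x \<and> f y)" for x f
  have local: "local_rule G g" unfolding local_rule_def g_def by auto
  have mono: "mono (g x)" for x unfolding g_def by (intro monoI) auto
  define f where "f = run g w2 (\<lambda>_. False)"
  \<comment> \<open>Without the source \<open>b\<close> nothing gets infected, so the leading
    \<open>w1\<close> in \<open>w1 @ w2 @ w1\<close> is idle and the trailing one must fix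
    \<open>f\<close>.\<close>
  have "run g w (\<lambda>_. False) = (\<lambda>_. False)" if "b \<notin> set w" for w
    using that by (induction w) (auto simp: g_def fun_upd_idem)
  with run_hk_eq[OF local absorb, of "\<lambda>_. False"] b have fixed1: "run g w1 f = f"
    by (simp add: f_def)
  have fixed2: "run g w2 f = f"
    using run_hk_eq[OF local idem, of "\<lambda>_. False"] by (simp add: f_def)
  have incr: "f y \<le> g y f" for y
    using run_increasing[of g "\<lambda>_. False" w2] mono by (simp add: f_def)
  have fixed: "g x f = f x" if "x \<in> set w1 \<union> set w2" for x
    using run_fixed[of g f, OF mono incr] fixed1 fixed2 that by blast
  have "f a"
  proof (rule successively_propagate[OF chain])
    show "f b" using fixed[of b] b by (auto simp: g_def)
    fix u v assume "u \<rightarrow>\<^bsub>G\<^esub> v" "v \<in> insert a (set zs)" "f u"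
    moreover from this have "v \<in> set w1 \<union> set w2" using a zs by auto
    ultimately show "f v" using fixed[of v] by (auto simp: g_def)
  qed
  moreover have "\<not> f a" using a by (simp add: f_def run_notin)
  ultimately show False by simp
qed

section \<open>Zero words\<close>

text \<open>Absorption is demanded letter by letter; \<open>zero_word_absorb\<close> extends it to
  all words over \<open>set w\<close>, so the class of \<open>w\<close> is the zero of the submonoid
  generated by its letters.\<close>

definition zero_word :: "('a, 'b) pre_digraph \<Rightarrow> 'a list \<Rightarrow> bool" where
  "zero_word G w \<longleftrightarrow>
     set w \<subseteq> verts G \<and> (\<forall>x \<in> set w. hk_eq G (x # w) w \<and> hk_eq G (w @ [x]) w)"

lemma zero_word_absorb:
  assumes "zero_word G w" "set u \<subseteq> set w"
  shows zero_word_absorb_left: "hk_eq G (u @ w) w"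
    and zero_word_absorb_right: "hk_eq G (w @ u) w"
proof -
  have w: "set w \<subseteq> verts G" using assms by (simp add: zero_word_def)
  show "hk_eq G (u @ w) w" using assms(2)
  proof (induction u)
    case Nil then show ?case using w by (auto intro: hk_eq.refl)
  next
    case (Cons x u)
    then have "hk_eq G ([x] @ u @ w) ([x] @ w)" using w by (intro hk_eq_append_left) auto
    also have "hk_eq G ([x] @ w) w" using assms(1) Cons.prems by (auto simp: zero_word_def)
    finally show ?case by simp
  qed
  show "hk_eq G (w @ u) w" using assms(2)
  proof (induction u rule: rev_induct)
    case Nil then show ?case using w by (auto intro: hk_eq.refl)
  next
    case (snoc x u)
    then have "hk_eq G ((w @ u) @ [x]) (w @ [x])" using w by (intro hk_eq_append_right) auto
    also have "hk_eq G (w @ [x]) w" using assms(1) snoc.prems by (auto simp: zero_word_def)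
    finally show ?case by simp
  qed
qed

text \<open>Each word absorbs the other: \<open>u @ v\<close> equals both \<open>u\<close> and
  \<open>v\<close> in the monoid.\<close>

lemma zero_word_unique:
  assumes "zero_word G u" "zero_word G v" "set u = set v"
  shows "hk_eq G u v"
  using hk_eq.trans[OF hk_eq.sym[OF zero_word_absorb_right[OF assms(1), of v]]
      zero_word_absorb_left[OF assms(2), of u]] assms(3) by simp

lemma zero_word_cong:
  assumes "hk_eq G u v" "zero_word G u"
  shows "zero_word G v"
proof -
  have s: "set u = set v" "set v \<subseteq> verts G" using assms hk_eq_set hk_eq_verts by blast+
  have "hk_eq G (x # v) v \<and> hk_eq G (v @ [x]) v" if "x \<in> set v" for x
  proof
    have x: "set [x] \<subseteq> verts G" using that s by auto
    have "hk_eq G ([x] @ v) ([x] @ u)" by (rule hk_eq_append_left[OF hk_eq.sym[OF assms(1)] x])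
    also have "hk_eq G ([x] @ u) u" using assms(2) that s by (auto simp: zero_word_def)
    also note assms(1)
    finally show "hk_eq G (x # v) v" by simp
    have "hk_eq G (v @ [x]) (u @ [x])" by (rule hk_eq_append_right[OF hk_eq.sym[OF assms(1)] x])
    also have "hk_eq G (u @ [x]) u" using assms(2) that s by (auto simp: zero_word_def)
    also note assms(1)
    finally show "hk_eq G (v @ [x]) v" .
  qed
  with s show ?thesis by (simp add: zero_word_def)
qed

section \<open>Deletion of repeated letters and products of zero words\<close>

context simple_oriented_graph
begin

text \<open>Induction from the right end of \<open>u\<close>. Its last letter \<open>z\<close>
  equals \<open>x\<close>, commutes with it, or receives an arrow from it; in the last case the
  induction hypothesis supplies an extra \<open>x\<close> in front of \<open>z\<close>, and
  \<open>[x, z, x]\<close> collapses to \<open>[x, z]\<close>.\<close>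

lemma drop_right_occurrence:
  assumes "set u \<subseteq> verts G" "x \<in> verts G" "\<And>y. y \<in> set u \<Longrightarrow> \<not> y \<rightarrow>\<^bsub>G\<^esub> x"
  shows "hk_eq G (x # u @ [x]) (x # u)"
  using assms
proof (induction u rule: rev_induct)
  case Nil then show ?case by (auto intro: hk_eq.idem)
next
  case (snoc z u)
  then have V: "x \<in> verts G" "z \<in> verts G" "set u \<subseteq> verts G" by auto
  have IH: "hk_eq G (x # u @ [x]) (x # u)" using snoc by auto
  consider "z = x" | "x \<rightarrow>\<^bsub>G\<^esub> z" | "not_connected G z x"
    using snoc.prems unfolding not_connected_def by auto
  then show ?case
  proof cases
    case 1
    have "hk_eq G ((x # u) @ [x, x]) ((x # u) @ [x])"
      using V by (intro hk_eq_append_left hk_eq.idem) auto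
    with 1 show ?thesis by simp
  next
    case 2
    have "hk_eq G ((x # u) @ [z, x]) ((x # u @ [x]) @ [z, x])"
      using V hk_eq_append_right[OF hk_eq.sym[OF IH], of "[z, x]"] by simp
    also have "hk_eq G ((x # u @ [x]) @ [z, x]) ((x # u) @ [x, z])"
      using V 2 hk_eq_append_left[OF hk_eq.arrow1[of x G z], of "x # u"] by simp
    also have "hk_eq G ((x # u) @ [x, z]) ((x # u) @ [z])"
      using V hk_eq_append_right[OF IH, of "[z]"] by simp
    finally show ?thesis by simp
  next
    case 3
    have "hk_eq G ((x # u) @ [z, x]) ((x # u) @ [x, z])"
      using V 3 by (intro hk_eq_append_left hk_eq.comm) auto
    also have "hk_eq G ((x # u) @ [x, z]) ((x # u) @ [z])"
      using V hk_eq_append_right[OF IH, of "[z]"] by simp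
    finally show ?thesis by simp
  qed
qed

text \<open>The mirror image: now an arrow can only lead from \<open>z\<close> to \<open>x\<close>,
  and \<open>[x, z, x]\<close> collapses to \<open>[z, x]\<close>.\<close>

lemma drop_left_occurrence:
  assumes "set u \<subseteq> verts G" "x \<in> verts G" "\<And>y. y \<in> set u \<Longrightarrow> \<not> x \<rightarrow>\<^bsub>G\<^esub> y"
  shows "hk_eq G (x # u @ [x]) (u @ [x])"
  using assms
proof (induction u)
  case Nil then show ?case by (auto intro: hk_eq.idem)
next
  case (Cons z u)
  then have V: "x \<in> verts G" "z \<in> verts G" "set u \<subseteq> verts G" by auto
  have IH: "hk_eq G (x # u @ [x]) (u @ [x])" using Cons by auto
  consider "z = x" | "z \<rightarrow>\<^bsub>G\<^esub> x" | "not_connected G x z"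
    using Cons.prems unfolding not_connected_def by auto
  then show ?case
  proof cases
    case 1
    have "hk_eq G ([x, x] @ u @ [x]) ([x] @ u @ [x])"
      using V by (intro hk_eq_append_right hk_eq.idem) auto
    with 1 show ?thesis by simp
  next
    case 2
    have "hk_eq G ([x, z] @ u @ [x]) ([x, z] @ x # u @ [x])"
      using V by (intro hk_eq_append_left hk_eq.sym[OF IH]) auto
    also have "hk_eq G ([x, z] @ x # u @ [x]) ([z, x] @ u @ [x])"
      using V 2 hk_eq_append_right[OF hk_eq.arrow2[of z G x], of "u @ [x]"] by simp
    also have "hk_eq G ([z, x] @ u @ [x]) ([z] @ u @ [x])"
      using V hk_eq_append_left[OF IH, of "[z]"] by simp
    finally show ?thesis by simp
  next
    case 3
    have "hk_eq G ([x, z] @ u @ [x]) ([z, x] @ u @ [x])"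
      using V 3 by (intro hk_eq_append_right hk_eq.comm) auto
    also have "hk_eq G ([z, x] @ u @ [x]) ([z] @ u @ [x])"
      using V hk_eq_append_left[OF IH, of "[z]"] by simp
    finally show ?thesis by simp
  qed
qed

text \<open>For \<open>x\<close> in \<open>u\<close>, the word \<open>u\<close> releases a copy of
  \<open>x\<close> in front of \<open>v\<close>, against which a trailing \<open>x\<close> is
  deleted; then \<open>u\<close> takes the copy back. A letter of \<open>v\<close> put in front of
  \<open>u\<close> is treated dually.\<close>

lemma zero_word_append:
  assumes "zero_word G u" "zero_word G v"
    and noarc: "\<And>x y. x \<in> set u \<Longrightarrow> y \<in> set v \<Longrightarrow> \<not> y \<rightarrow>\<^bsub>G\<^esub> x"
  shows "zero_word G (u @ v)"
proof -
  have V: "set u \<subseteq> verts G" "set v \<subseteq> verts G" using assms by (auto simp: zero_word_def)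
  have "hk_eq G (x # u @ v) (u @ v) \<and> hk_eq G (u @ v @ [x]) (u @ v)" if "x \<in> set u" for x
  proof
    show "hk_eq G (x # u @ v) (u @ v)"
      using hk_eq_append_right[OF zero_word_absorb_left[OF assms(1), of "[x]"] V(2)] that by simp
    have ux: "hk_eq G (u @ [x]) u" using zero_word_absorb_right[OF assms(1)] that by simp
    have x: "set [x] \<subseteq> verts G" using that V by auto
    have "hk_eq G (u @ v @ [x]) ((u @ [x]) @ v @ [x])"
      using V x by (intro hk_eq_append_right hk_eq.sym[OF ux]) auto
    also have "hk_eq G ((u @ [x]) @ v @ [x]) ((u @ [x]) @ v)"
      using V x noarc[OF that] hk_eq_append_left[OF drop_right_occurrence[of v x], of u] by simp
    also have "hk_eq G ((u @ [x]) @ v) (u @ v)"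
      by (rule hk_eq_append_right[OF ux V(2)])
    finally show "hk_eq G (u @ v @ [x]) (u @ v)" .
  qed
  moreover have "hk_eq G (y # u @ v) (u @ v) \<and> hk_eq G (u @ v @ [y]) (u @ v)"
    if "y \<in> set v" for y
  proof
    show "hk_eq G (u @ v @ [y]) (u @ v)"
      using hk_eq_append_left[OF zero_word_absorb_right[OF assms(2), of "[y]"] V(1)] that by simp
    have yv: "hk_eq G ([y] @ v) v" using zero_word_absorb_left[OF assms(2), of "[y]"] that by simp
    have y: "set [y] \<subseteq> verts G" using that V by auto
    have "hk_eq G (([y] @ u) @ v) (([y] @ u) @ [y] @ v)"
      using V y by (intro hk_eq_append_left hk_eq.sym[OF yv]) auto
    also have "hk_eq G (([y] @ u) @ [y] @ v) (u @ [y] @ v)"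
      using V y noarc[OF _ that] hk_eq_append_right[OF drop_left_occurrence[of u y], of v] by simp
    also have "hk_eq G (u @ [y] @ v) (u @ v)"
      by (rule hk_eq_append_left[OF yv V(1)])
    finally show "hk_eq G (y # u @ v) (u @ v)" by simp
  qed
  ultimately show ?thesis using V by (auto simp: zero_word_def)
qed

lemma zero_word_singleton: "x \<in> verts G \<Longrightarrow> zero_word G [x]"
  by (simp add: zero_word_def hk_eq.idem)

section \<open>Sinks of acyclic sets and existence of zero words\<close>

lemma acyclic_sets_finite: "X \<in> acyclic_sets G \<Longrightarrow> finite X"
  unfolding acyclic_sets_def using finite_subset finite_verts by blast

lemma acyclic_sets_sink:
  assumes "X \<in> acyclic_sets G" "X \<noteq> {}"
  obtains t where "t \<in> X" "\<And>y. y \<in> X \<Longrightarrow> \<not> t \<rightarrow>\<^bsub>G\<^esub> y"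
proof -
  let ?R = "arcs_ends (G \<restriction> X)"
  have "finite ?R"
    by (rule finite_subset[of _ "X \<times> X"])
      (auto simp: dominates_induce_subgraph_iff acyclic_sets_finite[OF assms(1)])
  \<comment> \<open>A minimal element for the converse of the arrow relation is a sink.\<close>
  then have "wf (?R\<inverse>)"
    using assms(1) by (intro finite_acyclic_wf_converse) (auto simp: mem_acyclic_sets_iff wf_digraph_axioms)
  then obtain t where t: "t \<in> X" "\<And>y. (y, t) \<in> ?R\<inverse> \<Longrightarrow> y \<notin> X"
    using assms(2) by (metis wfE_min all_not_in_conv)
  have "\<not> t \<rightarrow>\<^bsub>G\<^esub> y" if "y \<in> X" for y
    using t(1) t(2)[of y] that dominates_induce_subgraph_iff by blast
  with t(1) show ?thesis by (rule that)
qed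

text \<open>Sinks are peeled off one at a time, so a set grows by vertices without arrows into the
  part already present. In this order letters can be appended to a zero word.\<close>

lemma acyclic_sets_induct [consumes 1, case_names empty insert]:
  assumes "X \<in> acyclic_sets G"
    and "P {}"
    and "\<And>t X. t \<notin> X \<Longrightarrow> insert t X \<in> acyclic_sets G \<Longrightarrow> \<forall>y \<in> insert t X. \<not> t \<rightarrow>\<^bsub>G\<^esub> y \<Longrightarrow> P X \<Longrightarrow> P (insert t X)"
  shows "P X"
  using assms(1)
proof (induction "card X" arbitrary: X rule: less_induct)
  case less
  show ?case
  proof (cases "X = {}")
    case False
    then obtain t where t: "t \<in> X" "\<And>y. y \<in> X \<Longrightarrow> \<not> t \<rightarrow>\<^bsub>G\<^esub> y"
      using acyclic_sets_sink less.prems by blast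
    have "P (X - {t})"
    proof (rule less.hyps)
      show "card (X - {t}) < card X"
        using t acyclic_sets_finite[OF less.prems] by (intro card_Diff1_less)
      show "X - {t} \<in> acyclic_sets G"
        by (rule acyclic_sets_mono[OF wf_digraph_axioms less.prems]) auto
    qed
    then show ?thesis using assms(3)[of t "X - {t}"] t less.prems by (simp add: insert_absorb)
  qed (use assms(2) in simp)
qed

text \<open>The word constructed lists \<open>X\<close> in a topological order, each sink following
  the zero word on the rest.\<close>

lemma zero_word_exists:
  assumes "X \<in> acyclic_sets G"
  obtains w where "zero_word G w" "set w = X"
proof -
  from assms have "\<exists>w. zero_word G w \<and> set w = X"
  proof (induction rule: acyclic_sets_induct)
    case empty then show ?case by (auto simp: zero_word_def)
  next
    case (insert t X)
    then obtain w where "zero_word G w" "set w = X" by blast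
    moreover have "t \<in> verts G" using insert.hyps by (auto simp: acyclic_sets_def)
    ultimately have "zero_word G (w @ [t])" "set (w @ [t]) = insert t X"
      using insert.hyps by (auto intro!: zero_word_append zero_word_singleton)
    then show ?case by blast
  qed
  with that show ?thesis by blast
qed

lemma filter_before_sink:
  assumes "set u \<subseteq> verts G" "t \<in> verts G" "\<And>y. y \<in> set u \<Longrightarrow> \<not> t \<rightarrow>\<^bsub>G\<^esub> y"
  shows "hk_eq G (u @ [t]) (filter ((\<noteq>) t) u @ [t])"
  using assms
proof (induction u)
  case Nil then show ?case by (auto intro: hk_eq.refl)
next
  case (Cons z u)
  then have IH: "hk_eq G (u @ [t]) (filter ((\<noteq>) t) u @ [t])" by auto
  show ?case
  proof (cases "z = t")
    case True
    have "hk_eq G (t # u @ [t]) (u @ [t])" using Cons.prems by (intro drop_left_occurrence) auto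
    also note IH
    finally show ?thesis using True by simp
  next
    case False
    with hk_eq_append_left[OF IH, of "[z]"] Cons.prems show ?thesis by simp
  qed
qed

text \<open>Since \<open>w\<close> is equal to \<open>w @ w\<close>, all occurrences of a sink \<open>t\<close> but the last one may be deleted,
  and the prefix obtained from the first copy of \<open>w\<close> is a zero word by induction.\<close>

lemma idempotent_imp_zero_word:
  assumes "hk_eq G (w @ w) w"
  shows "zero_word G w"
proof -
  have "zero_word G w" if "X \<in> acyclic_sets G" "hk_eq G (w @ w) w" "set w = X" for X w
    using that
  proof (induction arbitrary: w rule: acyclic_sets_induct)
    case empty then show ?case by (simp add: zero_word_def)
  next
    case (insert t X)
    let ?d = "filter ((\<noteq>) t)"
    have V: "set w \<subseteq> verts G" "t \<in> verts G"
      using insert.hyps insert.prems by (auto simp: acyclic_sets_def)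
    have sink: "\<not> t \<rightarrow>\<^bsub>G\<^esub> y" if "y \<in> set w" for y using that insert by auto
    have "t \<in> set w" using insert.prems by auto
    then obtain w1 w2 where w: "w = w1 @ t # w2" "t \<notin> set w2" by (meson split_list_last)
    have dw: "set (?d w) = X" using insert.hyps insert.prems by auto
    have zd: "zero_word G (?d w)"
    proof (rule insert.IH)
      show "hk_eq G (?d w @ ?d w) (?d w)" using hk_eq_filter[OF insert.prems(1), of "(\<noteq>) t"] by simp
    qed (rule dw)
    have zt: "zero_word G (?d w @ [t])"
      using zd V sink by (intro zero_word_append zero_word_singleton) auto
    \<comment> \<open>The second copy of \<open>w\<close> is cut at its last \<open>t\<close>. The
      first copy supplies the zero word \<open>?d w\<close>, which absorbs the filtered
      \<open>w1\<close>; then \<open>?d w @ [t]\<close> absorbs \<open>w2\<close>.\<close>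
    have "hk_eq G ((w @ w1) @ [t]) (?d (w @ w1) @ [t])"
      using V sink w(1) by (intro filter_before_sink) auto
    also have "hk_eq G (?d (w @ w1) @ [t]) (?d w @ [t])"
      using hk_eq_append_right[OF zero_word_absorb_right[OF zd, of "?d w1"], of "[t]"] V w(1)
      by auto
    finally have "hk_eq G (((w @ w1) @ [t]) @ w2) ((?d w @ [t]) @ w2)"
      by (rule hk_eq_append_right) (use V w(1) in auto)
    also have "hk_eq G ((?d w @ [t]) @ w2) (?d w @ [t])"
      using w by (intro zero_word_absorb_right[OF zt]) auto
    finally have "hk_eq G (w @ w) (?d w @ [t])" using w(1) by simp
    then have "hk_eq G (?d w @ [t]) w" using insert.prems(1) hk_eq.sym hk_eq.trans by blast
    with zt show ?case by (rule zero_word_cong[rotated])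
  qed
  with idempotent_imp_acyclic[OF assms] assms show ?thesis by blast
qed

text \<open>Let \<open>D\<close> be the part of \<open>X \<inter> Y\<close> that is reachable from \<open>Y - X\<close> inside \<open>X \<inter> Y\<close>.  The zero word on
  \<open>Y\<close> can be written with the letters of \<open>X \<inter> Y - D\<close> in front, where the zero word on \<open>X\<close> absorbs
  them; the zero word on \<open>X\<close> can be written with the letters of \<open>D\<close> at the end, where the rest of \<open>Y\<close>
  absorbs them.  No arrow leads from what is left of \<open>Y\<close> to what is left of \<open>X\<close>.\<close>

lemma p_cond_imp_zero_word:
  assumes u: "zero_word G u" "set u \<in> acyclic_sets G"
    and v: "zero_word G v" "set v \<in> acyclic_sets G"
    and p: "p_cond G (set u) (set v)"
  shows "zero_word G (u @ v)"
proof -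
  define C where "C = set u \<inter> set v"
  define D where
    "D = {c \<in> C. \<exists>b \<in> set v - set u. \<exists>zs \<in> lists C. successively (\<lambda>u v. u \<rightarrow>\<^bsub>G\<^esub> v) (b # zs @ [c])}"
  note sub = acyclic_sets_mono[OF wf_digraph_axioms u(2)] acyclic_sets_mono[OF wf_digraph_axioms v(2)]
  have D: "D \<subseteq> C" by (auto simp: D_def)
  \<comment> \<open>An arrow ending in the intersection extends a chain, so its end lies in
    \<open>D\<close>; one ending in \<open>set u - set v\<close> would complete a chain forbidden by
    \<open>p\<close>. The three concatenations below rest on this.\<close>
  have reach: "x \<in> D \<union> - set u" if "y \<in> set v - set u \<union> D" "y \<rightarrow>\<^bsub>G\<^esub> x" for x y
  proof -
    have "\<exists>b \<in> set v - set u. \<exists>zs \<in> lists C. successively (\<lambda>u v. u \<rightarrow>\<^bsub>G\<^esub> v) (b # zs @ [x])"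
    proof (cases "y \<in> D")
      case True
      then obtain b zs where "y \<in> C" "b \<in> set v - set u" "zs \<in> lists C"
        "successively (\<lambda>u v. u \<rightarrow>\<^bsub>G\<^esub> v) (b # zs @ [y])"
        unfolding D_def by blast
      with that(2) show ?thesis
        by (intro bexI[of _ b] bexI[of _ "zs @ [y]"]) (auto simp: successively_append_iff simp flip: append_Cons)
    next
      case False
      with that show ?thesis by (intro bexI[of _ y] bexI[of _ "[]"]) auto
    qed
    then show ?thesis using p unfolding p_cond_def D_def C_def by blast
  qed
  \<comment> \<open>\<open>d\<close> holds the letters moved to the end of \<open>u\<close>,
    \<open>c\<close> those moved to the front of \<open>v\<close>; the product shrinks to
    \<open>e @ r\<close>.\<close>
  obtain e where e: "zero_word G e" "set e = set u - D"
    using zero_word_exists[OF sub(1), of "set u - D"] by blast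
  obtain d where d: "zero_word G d" "set d = D"
    using zero_word_exists[OF sub(1), of D] D C_def by blast
  obtain c where c: "zero_word G c" "set c = C - D"
    using zero_word_exists[OF sub(1), of "C - D"] C_def by blast
  obtain r where r: "zero_word G r" "set r = set v - set u \<union> D"
    using zero_word_exists[OF sub(2), of "set v - set u \<union> D"] D C_def by blast
  have V: "set u \<subseteq> verts G" "set v \<subseteq> verts G" using u v by (auto simp: zero_word_def)
  have setu: "set (e @ d) = set u" and setv: "set (c @ r) = set v"
    using D e d c r by (auto simp: C_def)
  have "zero_word G (e @ d)"
    by (rule zero_word_append[OF e(1) d(1)]) (use reach e d in blast)
  then have ued: "hk_eq G u (e @ d)" using setu by (intro zero_word_unique u) auto
  have "zero_word G (c @ r)"
    by (rule zero_word_append[OF c(1) r(1)]) (use reach c r in \<open>auto simp: C_def\<close>)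
  then have vcr: "hk_eq G v (c @ r)" using setv by (intro zero_word_unique v) auto
  have "hk_eq G (u @ v) ((u @ c) @ r)" using hk_eq_append_left[OF vcr V(1)] by simp
  also have "hk_eq G ((u @ c) @ r) (u @ r)"
    by (rule hk_eq_append_right[OF zero_word_absorb_right[OF u(1)]]) (use V setv c in \<open>auto simp: C_def\<close>)
  also have "hk_eq G (u @ r) ((e @ d) @ r)"
    by (rule hk_eq_append_right[OF ued]) (use V setv in auto)
  also have "hk_eq G ((e @ d) @ r) (e @ r)"
    using hk_eq_append_left[OF zero_word_absorb_left[OF r(1), of d], of e] V setu d r by auto
  finally have "hk_eq G (e @ r) (u @ v)" by (rule hk_eq.sym)
  moreover have "zero_word G (e @ r)"
    by (rule zero_word_append[OF e(1) r(1)]) (use reach e r in blast)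
  ultimately show ?thesis by (rule zero_word_cong)
qed

end

section \<open>Homomorphisms\<close>

lemma concat_map_in_lists:
  "(\<And>x. x \<in> verts G \<Longrightarrow> set (e x) \<subseteq> verts H) \<Longrightarrow> set w \<subseteq> verts G \<Longrightarrow>
     concat (map e w) \<in> lists (verts H)"
  unfolding in_lists_conv_set set_concat set_map by blast

lemma monoid_Hom_hk_class:
  assumes \<phi>: "\<phi> \<in> monoid_Hom (HK G) (HK H)"
    and e: "\<And>x. x \<in> verts G \<Longrightarrow> set (e x) \<subseteq> verts H \<and> \<phi> (hk_gen G x) = hk_class H (e x)"
    and "set w \<subseteq> verts G"
  shows "\<phi> (hk_class G w) = hk_class H (concat (map e w))"
  using assms(3)
proof (induction w)
  case Nil
  then show ?case using \<phi> by (simp add: monoid_Hom_def one_HK)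
next
  case (Cons x w)
  have L: "[x] \<in> lists (verts G)" "w \<in> lists (verts G)" "e x \<in> lists (verts H)"
    using Cons.prems e[of x] by auto
  have Lw: "concat (map e w) \<in> lists (verts H)"
    by (rule concat_map_in_lists[of G]) (use e Cons.prems in auto)
  have "\<phi> (hk_class G (x # w)) = \<phi> (hk_class G [x] \<otimes>\<^bsub>HK G\<^esub> hk_class G w)"
    using mult_hk_class[OF L(1,2)] by simp
  also have "\<dots> = \<phi> (hk_class G [x]) \<otimes>\<^bsub>HK H\<^esub> \<phi> (hk_class G w)"
    using \<phi> L by (intro hom_mult[of \<phi>]) (auto simp: monoid_Hom_def carrier_HK)
  also have "\<dots> = hk_class H (e x) \<otimes>\<^bsub>HK H\<^esub> hk_class H (concat (map e w))"
    using Cons e[of x] by (simp add: hk_gen_def)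
  also have "\<dots> = hk_class H (concat (map e (x # w)))"
    using mult_hk_class[OF L(3) Lw] by simp
  finally show ?case .
qed

text \<open>Representatives of the images of the generators turn a homomorphism into a substitution
  of words for letters.\<close>

lemma monoid_Hom_words:
  assumes \<phi>: "\<phi> \<in> monoid_Hom (HK G) (HK H)"
  obtains e where "\<And>x. x \<in> verts G \<Longrightarrow> set (e x) \<subseteq> verts H \<and> \<phi> (hk_gen G x) = hk_class H (e x)"
proof -
  have "\<exists>w. set w \<subseteq> verts H \<and> \<phi> (hk_gen G x) = hk_class H w" if "x \<in> verts G" for x
  proof -
    have "[x] \<in> lists (verts G)" using that by simp
    then have "hk_gen G x \<in> carrier (HK G)" unfolding hk_gen_def carrier_HK by (rule imageI)
    with \<phi> have "\<phi> (hk_gen G x) \<in> carrier (HK H)"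
      unfolding monoid_Hom_def by (blast dest: hom_in_carrier)
    then show ?thesis by (auto simp: carrier_HK)
  qed
  then show ?thesis using that by metis
qed

lemma monoid_Hom_hk_eq:
  assumes "\<phi> \<in> monoid_Hom (HK G) (HK H)"
    and e: "\<And>x. x \<in> verts G \<Longrightarrow> set (e x) \<subseteq> verts H \<and> \<phi> (hk_gen G x) = hk_class H (e x)"
    and "hk_eq G u v"
  shows "hk_eq H (concat (map e u)) (concat (map e v))"
proof -
  have V: "set u \<subseteq> verts G" "set v \<subseteq> verts G" using hk_eq_verts assms(3) by blast+
  have "hk_class G u = hk_class G v"
    using assms(3) V by (subst hk_class_eq_iff) auto
  then have "hk_class H (concat (map e u)) = hk_class H (concat (map e v))"
    using monoid_Hom_hk_class[OF assms(1) e] V by metis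
  moreover have "concat (map e w) \<in> lists (verts H)" if "set w \<subseteq> verts G" for w
    by (rule concat_map_in_lists[of G]) (use e that in auto)
  ultimately show ?thesis using V by (simp add: hk_class_eq_iff)
qed

lemma monoid_Hom_eqI:
  assumes "\<phi> \<in> monoid_Hom (HK G) (HK H)" "\<psi> \<in> monoid_Hom (HK G) (HK H)"
    and eq: "\<And>x. x \<in> verts G \<Longrightarrow> \<phi> (hk_gen G x) = \<psi> (hk_gen G x)"
  shows "\<phi> = \<psi>"
proof -
  obtain e where e: "\<And>x. x \<in> verts G \<Longrightarrow> set (e x) \<subseteq> verts H \<and> \<phi> (hk_gen G x) = hk_class H (e x)"
    using monoid_Hom_words[OF assms(1)] by blast
  show ?thesis
  proof (rule extensionalityI)
    show "\<phi> \<in> extensional (carrier (HK G))" "\<psi> \<in> extensional (carrier (HK G))"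
      using assms by (auto simp: monoid_Hom_def)
    fix A assume "A \<in> carrier (HK G)"
    then obtain w where w: "set w \<subseteq> verts G" "A = hk_class G w" by (auto simp: carrier_HK)
    then show "\<phi> A = \<psi> A"
      using monoid_Hom_hk_class[OF assms(1), of e] monoid_Hom_hk_class[OF assms(2), of e] e eq by metis
  qed
qed

text \<open>The universal property of the presentation. By \<open>resp\<close> the representative
  chosen with \<open>SOME\<close> does not matter, and \<open>restrict\<close> makes the map
  extensional.\<close>

lemma monoid_Hom_lift:
  assumes e: "\<And>x. x \<in> verts G \<Longrightarrow> set (e x) \<subseteq> verts H"
    and resp: "\<And>u v. hk_eq G u v \<Longrightarrow> hk_eq H (concat (map e u)) (concat (map e v))"
  obtains \<phi> where "\<phi> \<in> monoid_Hom (HK G) (HK H)"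
    "\<And>w. set w \<subseteq> verts G \<Longrightarrow> \<phi> (hk_class G w) = hk_class H (concat (map e w))"
proof -
  define \<phi> where
    "\<phi> = restrict (\<lambda>A. hk_class H (concat (map e (SOME w. w \<in> A)))) (carrier (HK G))"
  have L: "concat (map e w) \<in> lists (verts H)" if "w \<in> lists (verts G)" for w
    by (rule concat_map_in_lists[of G]) (use e that in auto)
  have \<phi>: "\<phi> (hk_class G w) = hk_class H (concat (map e w))" if w: "w \<in> lists (verts G)" for w
  proof -
    let ?v = "SOME v. v \<in> hk_class G w"
    have "w \<in> hk_class G w" using w by (simp add: hk_class_def hk_rel_def hk_eq.refl)
    then have "?v \<in> hk_class G w" by (rule someI)
    then have eq: "hk_eq G w ?v" by (simp add: hk_class_def hk_rel_def)
    then have "?v \<in> lists (verts G)" using hk_eq_lists by blast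
    then have "hk_class H (concat (map e ?v)) = hk_class H (concat (map e w))"
      using L w resp[OF eq] by (subst hk_class_eq_iff) (auto intro: hk_eq.sym)
    then show ?thesis using w by (simp add: \<phi>_def carrier_HK)
  qed
  have "\<phi> \<in> hom (HK G) (HK H)"
  proof (rule homI)
    fix A B assume "A \<in> carrier (HK G)" "B \<in> carrier (HK G)"
    then obtain u v where uv: "u \<in> lists (verts G)" "v \<in> lists (verts G)"
      "A = hk_class G u" "B = hk_class G v" by (auto simp: carrier_HK)
    then show "\<phi> A \<in> carrier (HK H)"
      unfolding uv(3) \<phi>[OF uv(1)] carrier_HK by (intro imageI L)
    have "u @ v \<in> lists (verts G)" using uv by auto
    then show "\<phi> (A \<otimes>\<^bsub>HK G\<^esub> B) = \<phi> A \<otimes>\<^bsub>HK H\<^esub> \<phi> B"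
      unfolding uv(3,4) by (simp only: mult_hk_class uv(1,2) \<phi> L map_append concat_append)
  qed
  moreover have "\<phi> \<one>\<^bsub>HK G\<^esub> = \<one>\<^bsub>HK H\<^esub>" using \<phi>[of "[]"] by (simp add: one_HK)
  moreover have "\<phi> \<in> extensional (carrier (HK G))" by (simp add: \<phi>_def)
  ultimately show ?thesis using that[of \<phi>] \<phi> by (auto simp: monoid_Hom_def)
qed

lemma hk_eq_concat_map:
  assumes "\<And>x. x \<in> verts G \<Longrightarrow> set (e x) \<subseteq> verts H"
    and "\<And>x. x \<in> verts G \<Longrightarrow> hk_eq H (e x @ e x) (e x)"
    and "\<And>x y. x \<in> verts G \<Longrightarrow> y \<in> verts G \<Longrightarrow> not_connected G x y \<Longrightarrow>
      hk_eq H (e x @ e y) (e y @ e x)"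
    and "\<And>x y. x \<in> verts G \<Longrightarrow> y \<in> verts G \<Longrightarrow> x \<rightarrow>\<^bsub>G\<^esub> y \<Longrightarrow>
      hk_eq H (e x @ e y @ e x) (e x @ e y) \<and> hk_eq H (e y @ e x @ e y) (e x @ e y)"
    and "hk_eq G u v"
  shows "hk_eq H (concat (map e u)) (concat (map e v))"
  using assms(5)
proof (induction rule: hk_eq.induct)
  case (refl w)
  then show ?case using assms(1) by (intro hk_eq.refl concat_map_in_lists[of G]) auto
qed (use assms(2-4) in \<open>auto intro: hk_eq.sym hk_eq.trans hk_eq.mult\<close>)

section \<open>The bijection\<close>

text \<open>Column \<open>j\<close> records which vertices listed in \<open>xs\<close> belong to the
  set at position \<open>j\<close>; the subset condition makes this record complete.\<close>

lemma inj_on_Psi_map: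
  "inj_on (Psi_map xs) {Xs. length Xs = m \<and> (\<forall>X \<in> set Xs. X \<subseteq> set xs)}"
proof (rule inj_onI)
  fix Xs Ys
  assume "Xs \<in> {Xs. length Xs = m \<and> (\<forall>X \<in> set Xs. X \<subseteq> set xs)}"
    and "Ys \<in> {Xs. length Xs = m \<and> (\<forall>X \<in> set Xs. X \<subseteq> set xs)}"
    and eq: "Psi_map xs Xs = Psi_map xs Ys"
  then have len: "length Xs = m" "length Ys = m"
    and sub: "\<And>j. j < m \<Longrightarrow> Xs ! j \<subseteq> set xs \<and> Ys ! j \<subseteq> set xs" by auto
  show "Xs = Ys"
  proof (rule nth_equalityI)
    fix j assume "j < length Xs"
    then have j: "j < m" using len by simp
    have "xs ! i \<in> Xs ! j \<longleftrightarrow> xs ! i \<in> Ys ! j" if "i < length xs" for i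
      using arg_cong[OF eq, of "\<lambda>M. M $$ (i, j)"] that j len by (simp add: Psi_map_def)
    with sub[OF j] show "Xs ! j = Ys ! j" by (auto simp: subset_iff in_set_conv_nth)
  qed (simp add: len)
qed

text \<open>Images of generators are idempotent, hence given by zero words, and these are determined
  by their letters.\<close>

lemma inj_on_Phi_map:
  assumes "simple_oriented_graph \<Theta>" "set ys = verts \<Gamma>"
  shows "inj_on (Phi_map \<Gamma> ys) (monoid_Hom (HK \<Gamma>) (HK \<Theta>))"
proof (rule inj_onI)
  interpret T: simple_oriented_graph \<Theta> by fact
  fix \<phi> \<psi>
  assume \<phi>: "\<phi> \<in> monoid_Hom (HK \<Gamma>) (HK \<Theta>)" and \<psi>: "\<psi> \<in> monoid_Hom (HK \<Gamma>) (HK \<Theta>)"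
    and eq: "Phi_map \<Gamma> ys \<phi> = Phi_map \<Gamma> ys \<psi>"
  obtain e where e: "\<And>x. x \<in> verts \<Gamma> \<Longrightarrow> set (e x) \<subseteq> verts \<Theta> \<and> \<phi> (hk_gen \<Gamma> x) = hk_class \<Theta> (e x)"
    using monoid_Hom_words[OF \<phi>] by blast
  obtain e' where e': "\<And>x. x \<in> verts \<Gamma> \<Longrightarrow> set (e' x) \<subseteq> verts \<Theta> \<and> \<psi> (hk_gen \<Gamma> x) = hk_class \<Theta> (e' x)"
    using monoid_Hom_words[OF \<psi>] by blast
  show "\<phi> = \<psi>"
  proof (rule monoid_Hom_eqI[OF \<phi> \<psi>])
    fix x assume x: "x \<in> verts \<Gamma>"
    have L: "e x \<in> lists (verts \<Theta>)" "e' x \<in> lists (verts \<Theta>)" using e[OF x] e'[OF x] by auto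
    have "content (\<phi> (hk_gen \<Gamma> x)) = content (\<psi> (hk_gen \<Gamma> x))"
      using eq x assms(2) by (auto simp: Phi_map_def)
    then have "set (e x) = set (e' x)"
      using e[OF x] e'[OF x] L by (simp add: content_hk_class)
    moreover have "hk_eq \<Theta> (e x @ e x) (e x)" "hk_eq \<Theta> (e' x @ e' x) (e' x)"
      using monoid_Hom_hk_eq[OF \<phi> _ hk_eq.idem[OF x], of e] e
        monoid_Hom_hk_eq[OF \<psi> _ hk_eq.idem[OF x], of e'] e' by auto
    ultimately have "hk_eq \<Theta> (e x) (e' x)"
      using T.idempotent_imp_zero_word zero_word_unique by blast
    then show "\<phi> (hk_gen \<Gamma> x) = \<psi> (hk_gen \<Gamma> x)"
      using e[OF x] e'[OF x] L by (simp add: hk_class_eq_iff)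
  qed
qed

text \<open>Idempotence of the generators yields acyclic contents; commutation and arrow relations
  each make \<open>e x @ e y\<close> absorb a trailing \<open>e x\<close>, which forces the chain
  condition.\<close>

lemma Phi_map_admissible:
  assumes "simple_oriented_graph \<Theta>" "set ys = verts \<Gamma>"
    and \<phi>: "\<phi> \<in> monoid_Hom (HK \<Gamma>) (HK \<Theta>)"
  shows "admissible \<Gamma> \<Theta> ys (Phi_map \<Gamma> ys \<phi>)"
proof -
  interpret T: simple_oriented_graph \<Theta> by fact
  obtain e where e: "\<And>x. x \<in> verts \<Gamma> \<Longrightarrow> set (e x) \<subseteq> verts \<Theta> \<and> \<phi> (hk_gen \<Gamma> x) = hk_class \<Theta> (e x)"
    using monoid_Hom_words[OF \<phi>] by blast
  have hom: "hk_eq \<Theta> (concat (map e u)) (concat (map e v))" if "hk_eq \<Gamma> u v" for u v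
    using monoid_Hom_hk_eq[OF \<phi> _ that, of e] e by blast
  have idem: "hk_eq \<Theta> (e x @ e x) (e x)" if "x \<in> verts \<Gamma>" for x
    using hom[OF hk_eq.idem[OF that]] by simp
  have arrow: "p_cond \<Theta> (set (e x)) (set (e y))"
    if "x \<in> verts \<Gamma>" "y \<in> verts \<Gamma>" "x \<rightarrow>\<^bsub>\<Gamma>\<^esub> y" for x y
    using hom[OF hk_eq.arrow1[OF that]] idem that by (intro T.absorb_imp_p_cond) simp_all
  have nc: "p_cond \<Theta> (set (e x)) (set (e y))"
    if "x \<in> verts \<Gamma>" "y \<in> verts \<Gamma>" "not_connected \<Gamma> x y" for x y
  proof (rule T.absorb_imp_p_cond[OF idem[OF that(2)]])
    \<comment> \<open>Commuting idempotents absorb: the trailing \<open>e x\<close> moves past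
      \<open>e y\<close> and merges with the first one.\<close>
    have "hk_eq \<Theta> (e y @ e x) (e x @ e y)" using hk_eq.sym[OF hom[OF hk_eq.comm[OF that]]] by simp
    then have "hk_eq \<Theta> (e x @ e y @ e x) ((e x @ e x) @ e y)"
      using e[OF that(1)] hk_eq_append_left[of \<Theta> "e y @ e x" "e x @ e y" "e x"] by simp
    also have "hk_eq \<Theta> ((e x @ e x) @ e y) (e x @ e y)"
      using e[OF that(2)] by (intro hk_eq_append_right idem that) simp
    finally show "hk_eq \<Theta> (e x @ e y @ e x) (e x @ e y)" .
  qed
  have "Phi_map \<Gamma> ys \<phi> = map (\<lambda>y. set (e y)) ys"
    unfolding Phi_map_def
  proof (rule map_cong[OF HOL.refl])
    fix y assume "y \<in> set ys"
    then have y: "y \<in> verts \<Gamma>" using assms(2) by simp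
    then have "e y \<in> lists (verts \<Theta>)" using e by auto
    with e[OF y] show "content (\<phi> (hk_gen \<Gamma> y)) = set (e y)" by (simp add: content_hk_class)
  qed
  moreover have "not_connected \<Gamma> y x" if "not_connected \<Gamma> x y" for x y
    using that by (auto simp: not_connected_def)
  moreover have "ys ! i \<in> verts \<Gamma>" if "i < length ys" for i using that assms(2) nth_mem by blast
  ultimately show ?thesis
    using idem T.idempotent_imp_acyclic arrow nc unfolding admissible_def by simp
qed

text \<open>Each generator is sent to the zero word on its set. The chain condition makes the
  relevant products of two such words zero words on the union, so both sides of every defining
  relation agree.\<close>

lemma admissible_imp_Phi_map:
  assumes "simple_oriented_graph \<Theta>" "distinct ys" "set ys = verts \<Gamma>"
    and adm: "admissible \<Gamma> \<Theta> ys Xs"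
  obtains \<phi> where "\<phi> \<in> monoid_Hom (HK \<Gamma>) (HK \<Theta>)" "Phi_map \<Gamma> ys \<phi> = Xs"
proof -
  interpret T: simple_oriented_graph \<Theta> by fact
  have len: "length Xs = length ys" using adm by (simp add: admissible_def)
  have "\<forall>y \<in> verts \<Gamma>. \<exists>i < length ys. ys ! i = y" using assms(3) by (auto simp: in_set_conv_nth)
  \<comment> \<open>The position of a vertex in \<open>ys\<close>; distinctness later gives
    \<open>idx (ys ! i) = i\<close>.\<close>
  then obtain idx where idx: "\<And>y. y \<in> verts \<Gamma> \<Longrightarrow> idx y < length ys \<and> ys ! idx y = y" by metis
  have "\<forall>y \<in> verts \<Gamma>. \<exists>w. zero_word \<Theta> w \<and> set w = Xs ! idx y"
  proof
    fix y assume "y \<in> verts \<Gamma>"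
    then have "Xs ! idx y \<in> acyclic_sets \<Theta>" using adm idx by (auto simp: admissible_def)
    then show "\<exists>w. zero_word \<Theta> w \<and> set w = Xs ! idx y" using T.zero_word_exists by blast
  qed
  then obtain e where e: "\<And>y. y \<in> verts \<Gamma> \<Longrightarrow> zero_word \<Theta> (e y)"
    and set_e: "\<And>y. y \<in> verts \<Gamma> \<Longrightarrow> set (e y) = Xs ! idx y" by metis
  have V: "set (e y) \<subseteq> verts \<Theta>" if "y \<in> verts \<Gamma>" for y using e[OF that] by (simp add: zero_word_def)
  have acyc: "set (e y) \<in> acyclic_sets \<Theta>" if "y \<in> verts \<Gamma>" for y
    using adm idx[OF that] set_e[OF that] by (auto simp: admissible_def)
  have "p_cond \<Theta> (set (e x)) (set (e y))"
    if "x \<in> verts \<Gamma>" "y \<in> verts \<Gamma>" "x \<rightarrow>\<^bsub>\<Gamma>\<^esub> y \<or> not_connected \<Gamma> x y" for x y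
  proof -
    from adm idx[OF that(1)] idx[OF that(2)] have
      "not_connected \<Gamma> (ys ! idx x) (ys ! idx y) \<longrightarrow> p_cond \<Theta> (Xs ! idx x) (Xs ! idx y)"
      "ys ! idx x \<rightarrow>\<^bsub>\<Gamma>\<^esub> ys ! idx y \<longrightarrow> p_cond \<Theta> (Xs ! idx x) (Xs ! idx y)"
      unfolding admissible_def by blast+
    with that idx set_e show ?thesis by auto
  qed
  then have zero: "zero_word \<Theta> (e x @ e y)"
    if "x \<in> verts \<Gamma>" "y \<in> verts \<Gamma>" "x \<rightarrow>\<^bsub>\<Gamma>\<^esub> y \<or> not_connected \<Gamma> x y" for x y
    using that by (intro T.p_cond_imp_zero_word e acyc) auto
  have resp: "hk_eq \<Theta> (concat (map e u)) (concat (map e v))" if "hk_eq \<Gamma> u v" for u v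
  proof (rule hk_eq_concat_map[OF V _ _ _ that])
    show "hk_eq \<Theta> (e x @ e x) (e x)" if "x \<in> verts \<Gamma>" for x
      using zero_word_absorb_left[OF e[OF that]] by simp
    show "hk_eq \<Theta> (e x @ e y) (e y @ e x)"
      if "x \<in> verts \<Gamma>" "y \<in> verts \<Gamma>" "not_connected \<Gamma> x y" for x y
      using that by (intro zero_word_unique zero) (auto simp: not_connected_def)
    show "hk_eq \<Theta> (e x @ e y @ e x) (e x @ e y) \<and> hk_eq \<Theta> (e y @ e x @ e y) (e x @ e y)"
      if "x \<in> verts \<Gamma>" "y \<in> verts \<Gamma>" "x \<rightarrow>\<^bsub>\<Gamma>\<^esub> y" for x y
      using that zero_word_absorb_right[OF zero, of x y "e x"]
        zero_word_absorb_left[OF zero, of x y "e y"] by simp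
  qed
  obtain \<phi> where \<phi>: "\<phi> \<in> monoid_Hom (HK \<Gamma>) (HK \<Theta>)"
    "\<And>w. set w \<subseteq> verts \<Gamma> \<Longrightarrow> \<phi> (hk_class \<Gamma> w) = hk_class \<Theta> (concat (map e w))"
    using monoid_Hom_lift[of \<Gamma> e \<Theta>] V resp by blast
  have "Phi_map \<Gamma> ys \<phi> = Xs"
  proof (rule nth_equalityI)
    fix i assume "i < length (Phi_map \<Gamma> ys \<phi>)"
    then have i: "i < length ys" by (simp add: Phi_map_def)
    then have y: "ys ! i \<in> verts \<Gamma>" using assms(3) nth_mem by blast
    then have "idx (ys ! i) = i" using idx[OF y] i assms(2) nth_eq_iff_index_eq by metis
    moreover have "content (hk_class \<Theta> (e (ys ! i))) = set (e (ys ! i))"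
      using V[OF y] by (intro content_hk_class) auto
    ultimately show "Phi_map \<Gamma> ys \<phi> ! i = Xs ! i"
      using i y \<phi>(2)[of "[ys ! i]"] set_e[OF y] by (simp add: Phi_map_def hk_gen_def)
  qed (simp add: Phi_map_def len)
  with \<phi>(1) that show ?thesis by blast
qed

theorem theorem4p5:
  fixes \<Gamma> :: "('a, 'b) pre_digraph" and \<Theta> :: "('c, 'd) pre_digraph"
    and ys :: "'a list" and xs :: "'c list"
  assumes "simple_oriented_graph \<Gamma>" and "simple_oriented_graph \<Theta>"
    and "distinct ys" and "set ys = verts \<Gamma>" and "length ys \<ge> 1"
    and "distinct xs" and "set xs = verts \<Theta>" and "length xs \<ge> 1"
  shows "bij_betw (Psi_map xs \<circ> Phi_map \<Gamma> ys)
           (monoid_Hom (HK \<Gamma>) (HK \<Theta>))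
           (Psi_map xs ` {Xs. admissible \<Gamma> \<Theta> ys Xs})"
proof (rule bij_betw_trans)
  show "bij_betw (Phi_map \<Gamma> ys) (monoid_Hom (HK \<Gamma>) (HK \<Theta>)) {Xs. admissible \<Gamma> \<Theta> ys Xs}"
    unfolding bij_betw_def
  proof
    show "inj_on (Phi_map \<Gamma> ys) (monoid_Hom (HK \<Gamma>) (HK \<Theta>))"
      by (rule inj_on_Phi_map[OF assms(2,4)])
    show "Phi_map \<Gamma> ys ` monoid_Hom (HK \<Gamma>) (HK \<Theta>) = {Xs. admissible \<Gamma> \<Theta> ys Xs}"
      using Phi_map_admissible[OF assms(2,4)] admissible_imp_Phi_map[OF assms(2,3,4)] by blast
  qed
  \<comment> \<open>Admissible sets consist of vertices, all listed in \<open>xs\<close>; this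
    places the sequences in the domain on which \<open>Psi_map\<close> is known to be
    injective.\<close>
  have "X \<subseteq> set xs" if "admissible \<Gamma> \<Theta> ys Xs" "X \<in> set Xs" for X Xs
  proof -
    from that obtain i where "i < length ys" "X = Xs ! i"
      by (auto simp: admissible_def in_set_conv_nth)
    then have "X \<in> acyclic_sets \<Theta>" using that(1) by (simp add: admissible_def)
    then show ?thesis using assms(7) by (simp add: acyclic_sets_def)
  qed
  then have "{Xs. admissible \<Gamma> \<Theta> ys Xs} \<subseteq> {Xs. length Xs = length ys \<and> (\<forall>X \<in> set Xs. X \<subseteq> set xs)}"
    by (auto simp: admissible_def)
  then show "bij_betw (Psi_map xs) {Xs. admissible \<Gamma> \<Theta> ys Xs} (Psi_map xs ` {Xs. admissible \<Gamma> \<Theta> ys Xs})"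
    by (intro inj_on_imp_bij_betw inj_on_subset[OF inj_on_Psi_map])
qed

end
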